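(* Let $\Omega$ be a finite measurable space with a probability measure $P$, in which every point is measurable and has positive measure. Let $n\ge 1$, let $P^n$ be the product measure on $\Omega^n$, and let $\mathcal{F}$ be a family of measurable functions $f:\Omega\to[0,1]$. Let $\varphi:\mathcal{F}\to(0,\infty)$ be a function and, for $x=(x_1,\ldots,x_n)\in\Omega^n$, put $$Z(x)=\sup_{f\in\mathcal{F}}\frac{1}{\varphi(f)}\sum_{i=1}^{n}\bigl(Pf-f(x_i)\bigr).$$ Assume that $\varphi$ is such that $Z$ has a finite median $M=M(Z)<\infty$, i.e. $$P^n(Z\ge M)\le \tfrac12\quad\text{and}\quad P^n(Z\ge M+\varepsilon)<\tfrac12\ \text{ for every }\varepsilon>0.$$ Let $L\approx 1.12$ be a positive number satisfying $$\frac{2L\,(e^{1/L}-1)}{1+2L}\le 1.$$ Then for every $u>0$, $$P^n\Bigl(\Bigl\{x\in\Omega^n:\ \exists f\in\mathcal{F},\ \sum_{i=1}^{n}\bigl(Pf-f(x_i)\bigr)\ge M\varphi(f)+2\sqrt{L\,n\,u\,Pf}\Bigr\}\Bigr)\le 2e^{-u}.$$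
   Context: $Pf=\int_\Omega f\,dP$ denotes the expectation of $f$ under $P$. *)

theory Defs
  imports "HOL-Probability.Probability"
begin

text \<open>
  The supremum is taken in the extended reals: for an infinite family it may be \<open>\<infinity>\<close>,
  and its finiteness is not assumed beyond the existence of a finite median.
\<close>

definition sup_dev ::
  "'a measure \<Rightarrow> nat \<Rightarrow> ('a \<Rightarrow> real) set \<Rightarrow> (('a \<Rightarrow> real) \<Rightarrow> real) \<Rightarrow> (nat \<Rightarrow> 'a) \<Rightarrow> ereal"
  where
  "sup_dev P n F \<phi> x =
     (SUP f\<in>F. ereal ((1 / \<phi> f) * (\<Sum>i=1..n. (integral\<^sup>L P f - f (x i)))))"

abbreviation power_measure :: "'a measure \<Rightarrow> nat \<Rightarrow> (nat \<Rightarrow> 'a) measure"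
  where "power_measure P n \<equiv> (\<Pi>\<^sub>M i\<in>{1..n}. P)"

text \<open>
  Every event in \<open>\<Omega>\<^sup>n\<close> is measurable, so \<^const>\<open>measure\<close> is never applied to a
  non-measurable set (where it would be zero by convention).
\<close>

lemma sets_power_measure_finite:
  assumes fin: "finite (space P)" and pt: "\<And>\<omega>. \<omega> \<in> space P \<Longrightarrow> {\<omega>} \<in> sets P"
  shows "sets (power_measure P n) = Pow (space (power_measure P n))"
proof
  show "sets (power_measure P n) \<subseteq> Pow (space (power_measure P n))"
    using sets.sets_into_space by blast
next
  have sp: "finite (space (power_measure P n))"
    using fin by (auto simp: space_PiM intro: finite_PiE)
  have sing: "{x} \<in> sets (power_measure P n)" if x: "x \<in> space (power_measure P n)" for x
  proof -
    have "{x} = (\<Pi>\<^sub>E i\<in>{1..n}. {x i})"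
      using x by (subst PiE_singleton) (auto simp: space_PiM PiE_def)
    also have "\<dots> \<in> sets (power_measure P n)"
      using x by (intro sets_PiM_I_finite) (auto simp: space_PiM intro!: pt)
    finally show ?thesis .
  qed
  show "Pow (space (power_measure P n)) \<subseteq> sets (power_measure P n)"
  proof
    fix A assume "A \<in> Pow (space (power_measure P n))"
    then have A: "A \<subseteq> space (power_measure P n)" by simp
    then have "(\<Union>x\<in>A. {x}) \<in> sets (power_measure P n)"
      using sp sing by (intro sets.finite_UN) (auto intro: finite_subset)
    then show "A \<in> sets (power_measure P n)" by simp
  qed
qed

end

theory Submission imports Defs begin

text \<open>
  Let \<open>A = {Z \<le> M}\<close>, an event of probability at least \<open>1/2\<close>. If \<open>x\<close> lies in the event to be
  bounded, with witness \<open>f\<close>, then subtracting the bound \<open>M \<phi> f\<close> that holds at every \<open>y \<in> A\<close> gives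
  \<open>\<Sum>\<^sub>i (f (y i) - f (x i)) \<ge> 2 \<surd>(L n u Pf)\<close> for all \<open>y \<in> A\<close>: a single function separates \<open>x\<close>
  from all of \<open>A\<close>. Rescaled to \<open>h = s f\<close> with \<open>s\<^sup>2 = u / (L n Pf)\<close>, this reads
  \<open>\<Sum>\<^sub>i (h (y i) - h (x i)) - L n P(h\<^sup>2) \<ge> u\<close>, because \<open>f\<^sup>2 \<le> f\<close>.

  The heart of the matter is a concentration inequality of transport type
  (\<open>transport_concentration\<close>): if \<open>c x\<close> is a lower bound over \<open>y \<in> A\<close> for this penalized gap, for
  functions \<open>h\<close> that may depend on \<open>x\<close> and have values in \<open>[0, 1/L]\<close>, then
  \<open>P\<^sup>n(A) \<cdot> \<integral> exp c dP\<^sup>n \<le> 1\<close>. With \<open>c = u\<close> on the bad event and \<open>c = 0\<close> elsewhere this is the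
  theorem. It is proved by induction on the number of coordinates. For a fixed last coordinate
  \<open>\<omega>\<close> of \<open>x\<close>, the minimum over \<open>A\<close> is at most any average, with weights \<open>\<Lambda> \<omega> \<eta>\<close>, of the minima over
  the sections \<open>A\<^sub>\<eta>\<close>; Hoelder's inequality and the induction hypothesis then bring in
  \<open>\<Prod>\<^sub>\<eta> P(A\<^sub>\<eta>)\<close> to the power \<open>-\<Lambda> \<omega> \<eta>\<close>. Everything thus depends on a good choice of \<open>\<Lambda>\<close>.

  With \<open>k \<eta> = - ln P(A\<^sub>\<eta>)\<close>, the optimal plan (\<open>one_coordinate_transport\<close>) moves mass from \<open>\<omega>\<close> to
  those \<open>\<eta>\<close> with a smaller value of \<open>k\<close>, with density \<open>2L (k \<omega> - k \<eta>)\<close>. As a plan has total mass 1,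
  \<open>k\<close> first has to be cut off at a level \<open>l\<close>, and this is where the upper bound on \<open>h\<close> is used.
  What remains is the one-dimensional inequality \<open>penalized_exp_moment_product\<close>, an upper bound for
  \<open>E e\<^bsup>k - L Q\<^esup> E e\<^bsup>-k\<^esup>\<close>, where \<open>Q\<close> is the one-sided variance of \<open>k\<close> around each of its values; it
  follows by symmetrizing the double sum.

  The hypothesis on \<open>L\<close> amounts to \<open>L \<ge> L\<^sub>0\<close> for a certain \<open>L\<^sub>0 > 10/9\<close>, and the claim gets weaker as
  \<open>L\<close> grows. So the argument is run with the single constant \<open>10/9\<close>, which the one-dimensional
  inequality just tolerates; correspondingly \<open>h \<le> 9/10\<close> throughout. The rescaled function satisfies this
  bound unless \<open>u > 9/10 \<cdot> n Pf\<close>; but then \<open>\<Sum>\<^sub>i f (y i) > 2 n Pf\<close> on all of \<open>A\<close>, which contradicts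
  Markov's inequality and \<open>P\<^sup>n(A) \<ge> 1/2\<close>. Functions with \<open>Pf = 0\<close> are excluded by
  \<open>P\<^sup>n(Z \<ge> M) \<le> 1/2\<close>: such an \<open>f\<close> vanishes, so \<open>Z \<ge> 0\<close> everywhere, while its deviation inequality
  forces \<open>M \<le> 0\<close>.
\<close>

section \<open>Numerical inequalities\<close>

lemma exp_nine_tenths: "exp (9/10::real) > 49/20"
proof -
  have "(\<Sum>m<6. (9/10::real)^m / fact m) \<le> exp (9/10)"
  proof -
    obtain t where "exp (9/10::real) = (\<Sum>m<6. (9/10)^m / fact m) + exp t / fact 6 * (9/10)^6"
      using Maclaurin_exp_le[of "9/10::real" 6] by blast
    then show ?thesis by simp
  qed
  moreover have "(\<Sum>m<6. (9/10::real)^m / fact m) > 49/20"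
    by (simp add: lessThan_nat_numeral fact_numeral power_divide)
  ultimately show ?thesis by linarith
qed

text \<open>
  In terms of \<open>y = 1/L\<close> the condition on \<open>L\<close> is \<open>2 e\<^sup>y \<le> y + 4\<close>, which fails at \<open>y = 9/10\<close> by a narrow margin
  (\<open>4.919\<close> against \<open>4.9\<close>), hence also for all larger \<open>y\<close>.
\<close>

lemma constant_ge:
  fixes L :: real
  assumes "L > 0" "2 * L * (exp (1 / L) - 1) / (1 + 2 * L) \<le> 1"
  shows "L \<ge> 10/9"
proof (rule ccontr)
  assume "\<not> ?thesis"
  then have y: "1 / L > 9/10" using assms(1) by (simp add: field_simps)
  define y where "y = 1 / L"
  have "2 * L * (exp y - 1) \<le> 1 + 2 * L"
    using assms by (simp add: y_def field_simps)
  then have "(2 * L * (exp y - 1)) * y \<le> (1 + 2 * L) * y"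
    using assms(1) by (intro mult_right_mono) (auto simp: y_def)
  moreover have "L * y = 1" using assms(1) by (simp add: y_def)
  ultimately have le: "2 * (exp y - 1) \<le> y + 2"
    by (simp add: algebra_simps) (metis (no_types, lifting) mult.assoc mult.commute mult.right_neutral)
  have "exp y = exp (9/10) * exp (y - 9/10)" by (simp add: exp_add[symmetric])
  moreover have "exp (y - 9/10) \<ge> 1 + (y - 9/10)" by (rule exp_ge_add_one_self)
  moreover have "exp (9/10) * exp (y - 9/10) \<ge> 49/20 * (1 + (y - 9/10))"
    using exp_nine_tenths y y_def exp_ge_add_one_self[of "y - 9/10"] by (intro mult_mono) auto
  ultimately have "exp y \<ge> 49/20 * (1 + (y - 9/10))" by simp
  then show False using le y y_def by simp
qed

text \<open>
  On \<open>[-9/10, 9/10]\<close> the best possible coefficient of \<open>s\<^sup>2\<close> is about \<open>0.5347\<close>. What matters is that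
  \<open>161/300\<close>, multiplied by \<open>9/10\<close>, is \<open>483/1000 < 1/2\<close>.
\<close>

lemma cosh_le_quadratic:
  fixes s :: real
  assumes "\<bar>s\<bar> \<le> 9/10"
  shows "exp s + exp (- s) \<le> 2 * (1 + 161/300 * s^2)"
proof -
  obtain t where t: "\<bar>t\<bar> \<le> \<bar>s\<bar>" "exp s = (\<Sum>m<6. s^m / fact m) + exp t / fact 6 * s^6"
    using Maclaurin_exp_le[of s 6] by blast
  obtain t' where t': "\<bar>t'\<bar> \<le> \<bar>-s\<bar>"
      "exp (-s) = (\<Sum>m<6. (-s)^m / fact m) + exp t' / fact 6 * (-s)^6"
    using Maclaurin_exp_le[of "-s" 6] by blast
  have e3: "exp r \<le> 3" if "\<bar>r\<bar> \<le> \<bar>s\<bar>" for r :: real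
  proof -
    have "exp r \<le> exp 1" using that assms by simp
    then show ?thesis using exp_le by linarith
  qed
  have "exp s + exp (-s) = 2 + s^2 + s^4/12 + (exp t + exp t') / 720 * s^6"
    unfolding t(2) t'(2)
    by (simp add: lessThan_nat_numeral fact_numeral field_simps)
  also have "\<dots> \<le> 2 + s^2 + s^4/12 + 6 / 720 * s^6"
    using e3[OF t(1)] e3[of t'] t'(1) by (intro add_mono mult_right_mono divide_right_mono) auto
  also have "\<dots> = 2 + s^2 * (1 + s^2/12 + (s^2)^2/120)"
    by (simp add: algebra_simps power_numeral_reduce)
  also have "\<dots> \<le> 2 + s^2 * (1 + (81/100)/12 + (81/100)^2/120)"
  proof -
    have "s^2 \<le> 81/100" using power_mono[OF assms, of 2] by (simp add: power_divide)
    then show ?thesis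
      by (intro add_mono mult_left_mono divide_right_mono power_mono) auto
  qed
  also have "\<dots> \<le> 2 * (1 + 161/300 * s^2)"
    by (simp add: power2_eq_square algebra_simps) 
  finally show ?thesis .
qed

text \<open>
  Equivalently \<open>(1 + b x) / (1 - b x) \<le> e\<^sup>x\<close> with \<open>b = 483/1000\<close>. The left side is \<open>1 + 2 b x + \<dots>\<close>, so
  that \<open>b < 1/2\<close> leaves room to first order, enough to absorb the higher-order terms on the
  interval in question. (For \<open>b = 1/2\<close> the left side is a Pade approximant of \<open>e\<^sup>x\<close> and exceeds it.)
\<close>

lemma scalar_inequality:
  fixes x :: real
  assumes "0 \<le> x" "x \<le> 9/20"
  shows "exp (- x) * (1 + 483/1000 * x) + 483/1000 * x \<le> 1"
proof -
  define b :: real where "b = 483/1000"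
  obtain t where t: "exp x = (\<Sum>m<4. x^m / fact m) + exp t / fact 4 * x^4"
    using Maclaurin_exp_le[of x 4] by blast
  have "exp x \<ge> (\<Sum>m<4. x^m / fact m)"
    unfolding t by simp
  also have "(\<Sum>m<4. x^m / fact m) = 1 + x + x^2/2 + x^3/6"
    by (simp add: lessThan_nat_numeral fact_numeral)
  finally have ex: "1 + x + x^2/2 + x^3/6 \<le> exp x" .
  have "0 \<le> x * (17/500 + 17/1000 * x - 449/6000 * x^2 - 161/2000 * x^3)"
  proof -
    have "x^2 \<le> (9/20)^2" "x^3 \<le> (9/20)^3"
      using assms by (auto intro!: power_mono)
    then show ?thesis using assms by (intro mult_nonneg_nonneg) (auto simp: power_divide)
  qed
  also have "\<dots> = (1 + x + x^2/2 + x^3/6) * (1 - b * x) - (1 + b * x)"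
    by (simp add: b_def field_simps power_numeral_reduce)
  finally have "1 + b * x \<le> (1 + x + x^2/2 + x^3/6) * (1 - b * x)" by simp
  also have "\<dots> \<le> exp x * (1 - b * x)"
    using ex assms by (intro mult_right_mono) (auto simp: b_def)
  finally have "exp (-x) * (1 + b * x) \<le> exp (-x) * (exp x * (1 - b * x))"
    by (intro mult_left_mono) auto
  also have "\<dots> = 1 - b * x" by (simp add: mult.assoc[symmetric] exp_add[symmetric])
  finally show ?thesis by (simp add: b_def)
qed

section \<open>Penalized exponential moments\<close>

text \<open>
  Without the penalty \<open>Q\<close> the product is at least 1 by Jensen's inequality, with an excess of about
  \<open>Var k = E Q\<close>, which a factor \<open>e\<^bsup>-Q\<^esup>\<close> would compensate to first order. The product
  is the double sum of \<open>r \<omega> exp (k \<omega> - k \<eta>)\<close> with \<open>r = e\<^bsup>- 10/9 Q\<^esup>\<close>. Since \<open>Q\<close> increases with \<open>k\<close>,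
  adding the terms for \<open>(\<omega>, \<eta>)\<close> and \<open>(\<eta>, \<omega>)\<close> replaces the exponential by a hyperbolic cosine, which
  is bounded by a quadratic. Splitting the square into its two one-sided parts, and dropping \<open>r \<le> 1\<close> in front
  of the second, produces \<open>E (r (1 + c Q) + c Q)\<close>, which is at most 1 pointwise. The hypothesis
  \<open>mass\<close> is what keeps \<open>Q\<close> in the range where this pointwise bound holds.
\<close>

lemma penalized_exp_moment_product:
  fixes \<Omega> :: "'a set" and p k :: "'a \<Rightarrow> real"
  defines "Q \<equiv> \<lambda>\<omega>. \<Sum>\<eta>\<in>\<Omega>. p \<eta> * (max 0 (k \<omega> - k \<eta>))^2"
  assumes fin: "finite \<Omega>" and p0: "\<And>\<omega>. \<omega> \<in> \<Omega> \<Longrightarrow> 0 \<le> p \<omega>" and p1: "sum p \<Omega> = 1"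
    and range: "\<And>\<omega> \<eta>. \<omega> \<in> \<Omega> \<Longrightarrow> \<eta> \<in> \<Omega> \<Longrightarrow> k \<omega> - k \<eta> \<le> 9/10"
    and mass: "\<And>\<omega>. \<omega> \<in> \<Omega> \<Longrightarrow> (\<Sum>\<eta>\<in>\<Omega>. p \<eta> * max 0 (k \<omega> - k \<eta>)) \<le> 9/20"
  shows "(\<Sum>\<omega>\<in>\<Omega>. p \<omega> * exp (k \<omega> - 10/9 * Q \<omega>)) * (\<Sum>\<omega>\<in>\<Omega>. p \<omega> * exp (- k \<omega>)) \<le> 1"
proof -
  define r where "r = (\<lambda>\<omega>. exp (- (10/9 * Q \<omega>)))"
  define c :: real where "c = 161/300"
  define lhs where "lhs = (\<Sum>\<omega>\<in>\<Omega>. \<Sum>\<eta>\<in>\<Omega>. p \<omega> * p \<eta> * (r \<omega> * exp (k \<omega> - k \<eta>)))"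
  have Q0: "0 \<le> Q \<omega>" if "\<omega> \<in> \<Omega>" for \<omega>
    unfolding Q_def using p0 that by (intro sum_nonneg) auto
  have Q1: "Q \<omega> \<le> 81/200" if w: "\<omega> \<in> \<Omega>" for \<omega>
  proof -
    have "Q \<omega> \<le> (\<Sum>\<eta>\<in>\<Omega>. 9/10 * (p \<eta> * max 0 (k \<omega> - k \<eta>)))"
      unfolding Q_def
    proof (rule sum_mono)
      fix \<eta> assume e: "\<eta> \<in> \<Omega>"
      have "(max 0 (k \<omega> - k \<eta>))^2 \<le> 9/10 * max 0 (k \<omega> - k \<eta>)"
        unfolding power2_eq_square using range[OF w e] by (intro mult_right_mono) (simp_all add: max_def)
      from mult_left_mono[OF this p0[OF e]]
      show "p \<eta> * (max 0 (k \<omega> - k \<eta>))^2 \<le> 9/10 * (p \<eta> * max 0 (k \<omega> - k \<eta>))"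
        by (simp add: algebra_simps)
    qed
    also have "\<dots> \<le> 9/10 * (9/20)"
      unfolding sum_distrib_left[symmetric] using mass[OF w] by simp
    finally show ?thesis by simp
  qed
  have mono: "Q \<eta> \<le> Q \<omega>" if "k \<eta> \<le> k \<omega>" for \<omega> \<eta>
    unfolding Q_def using p0 that by (intro sum_mono mult_left_mono power_mono) auto
  \<comment> \<open>\<open>2 (r e\<^sup>d + r' e\<^bsup>-d\<^esup>) = (r + r') (e\<^sup>d + e\<^bsup>-d\<^esup>) + (r - r') (e\<^sup>d - e\<^bsup>-d\<^esup>)\<close>, and the last
    product is nonpositive by the monotonicity of \<open>Q\<close>.\<close>
  have pair: "r \<omega> * exp (k \<omega> - k \<eta>) + r \<eta> * exp (k \<eta> - k \<omega>)
       \<le> (r \<omega> + r \<eta>) * (1 + c * (k \<omega> - k \<eta>)^2)" if w: "\<omega> \<in> \<Omega>" "\<eta> \<in> \<Omega>" for \<omega> \<eta>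
  proof -
    define d where "d = k \<omega> - k \<eta>"
    have "(r \<omega> - r \<eta>) * (exp d - exp (-d)) \<le> 0"
    proof (cases "d \<ge> 0")
      case True
      then have "r \<omega> \<le> r \<eta>" using mono[of \<eta> \<omega>] by (simp add: r_def d_def)
      then show ?thesis using True by (intro mult_nonpos_nonneg) auto
    next
      case False
      then have "r \<omega> \<ge> r \<eta>" using mono[of \<omega> \<eta>] by (simp add: r_def d_def)
      then show ?thesis using False by (intro mult_nonneg_nonpos) auto
    qed
    moreover have "2 * (r \<omega> * exp d + r \<eta> * exp (-d))
       = (r \<omega> + r \<eta>) * (exp d + exp (-d)) + (r \<omega> - r \<eta>) * (exp d - exp (-d))"
      by (simp add: algebra_simps)
    moreover have "(r \<omega> + r \<eta>) * (exp d + exp (-d)) \<le> (r \<omega> + r \<eta>) * (2 * (1 + c * d^2))"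
    proof (intro mult_left_mono)
      have "\<bar>d\<bar> \<le> 9/10"
        using range[OF w] range[OF w(2) w(1)] unfolding d_def by linarith
      then show "exp d + exp (-d) \<le> 2 * (1 + c * d^2)"
        using cosh_le_quadratic by (simp add: c_def)
    qed (simp add: r_def)
    ultimately have "r \<omega> * exp d + r \<eta> * exp (-d) \<le> (r \<omega> + r \<eta>) * (1 + c * d^2)"
      by (simp add: algebra_simps)
    then show ?thesis by (simp add: d_def)
  qed
  have swap: "lhs = (\<Sum>\<omega>\<in>\<Omega>. \<Sum>\<eta>\<in>\<Omega>. p \<omega> * p \<eta> * (r \<eta> * exp (k \<eta> - k \<omega>)))"
    unfolding lhs_def by (subst sum.swap) (simp add: mult.commute)
  have "2 * lhs = (\<Sum>\<omega>\<in>\<Omega>. \<Sum>\<eta>\<in>\<Omega>. p \<omega> * p \<eta> *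
             (r \<omega> * exp (k \<omega> - k \<eta>) + r \<eta> * exp (k \<eta> - k \<omega>)))"
    unfolding distrib_left sum.distrib swap[symmetric] lhs_def[symmetric] by simp
  also have "\<dots> \<le> (\<Sum>\<omega>\<in>\<Omega>. \<Sum>\<eta>\<in>\<Omega>. p \<omega> * p \<eta> * ((r \<omega> + r \<eta>) * (1 + c * (k \<omega> - k \<eta>)^2)))"
    using pair p0 by (intro sum_mono mult_left_mono) auto
  also have "\<dots> = (\<Sum>\<omega>\<in>\<Omega>. \<Sum>\<eta>\<in>\<Omega>. p \<omega> * p \<eta> * (r \<omega> * (1 + c * (k \<omega> - k \<eta>)^2)))
      + (\<Sum>\<omega>\<in>\<Omega>. \<Sum>\<eta>\<in>\<Omega>. p \<eta> * p \<omega> * (r \<eta> * (1 + c * (k \<eta> - k \<omega>)^2)))"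
    unfolding sum.distrib[symmetric]
    by (intro sum.cong) (auto simp: algebra_simps power2_commute)
  also have "\<dots> = 2 * (\<Sum>\<omega>\<in>\<Omega>. \<Sum>\<eta>\<in>\<Omega>. p \<omega> * p \<eta> * (r \<omega> * (1 + c * (k \<omega> - k \<eta>)^2)))"
    by (subst (2) sum.swap) simp
  finally have "lhs \<le> (\<Sum>\<omega>\<in>\<Omega>. \<Sum>\<eta>\<in>\<Omega>. p \<omega> * p \<eta> * (r \<omega> * (1 + c * (k \<omega> - k \<eta>)^2)))"
    by simp
  also have "\<dots> \<le> (\<Sum>\<omega>\<in>\<Omega>. \<Sum>\<eta>\<in>\<Omega>. p \<omega> * r \<omega> * p \<eta> + c * (p \<omega> * r \<omega>) * (p \<eta> * (max 0 (k \<omega> - k \<eta>))^2)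
        + c * (p \<eta> * (p \<omega> * (max 0 (k \<eta> - k \<omega>))^2)))"
  proof (intro sum_mono)
    fix \<omega> \<eta> assume w: "\<omega> \<in> \<Omega>" "\<eta> \<in> \<Omega>"
    have "(k \<omega> - k \<eta>)^2 = (max 0 (k \<omega> - k \<eta>))^2 + (max 0 (k \<eta> - k \<omega>))^2"
      by (auto simp: max_def power2_commute)
    moreover have "r \<omega> * (max 0 (k \<eta> - k \<omega>))^2 \<le> 1 * (max 0 (k \<eta> - k \<omega>))^2"
      using Q0[OF w(1)] by (intro mult_right_mono) (auto simp: r_def)
    ultimately have "r \<omega> * (1 + c * (k \<omega> - k \<eta>)^2)
       \<le> r \<omega> + c * r \<omega> * (max 0 (k \<omega> - k \<eta>))^2 + c * (max 0 (k \<eta> - k \<omega>))^2"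
      by (simp add: algebra_simps c_def)
    from mult_left_mono[OF this, of "p \<omega> * p \<eta>"] p0 w
    show "p \<omega> * p \<eta> * (r \<omega> * (1 + c * (k \<omega> - k \<eta>)^2))
       \<le> p \<omega> * r \<omega> * p \<eta> + c * (p \<omega> * r \<omega>) * (p \<eta> * (max 0 (k \<omega> - k \<eta>))^2)
        + c * (p \<eta> * (p \<omega> * (max 0 (k \<eta> - k \<omega>))^2))"
      by (simp add: algebra_simps)
  qed
  also have "\<dots> = (\<Sum>\<omega>\<in>\<Omega>. p \<omega> * r \<omega>) + (\<Sum>\<omega>\<in>\<Omega>. c * (p \<omega> * r \<omega>) * Q \<omega>) + (\<Sum>\<eta>\<in>\<Omega>. c * (p \<eta> * Q \<eta>))"
    unfolding sum.distrib
    by (subst (3) sum.swap) (simp add: sum_distrib_left[symmetric] p1 Q_def)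
  also have "\<dots> = (\<Sum>\<omega>\<in>\<Omega>. p \<omega> * (r \<omega> * (1 + c * Q \<omega>) + c * Q \<omega>))"
    unfolding sum.distrib[symmetric] by (simp add: algebra_simps)
  also have "\<dots> \<le> (\<Sum>\<omega>\<in>\<Omega>. p \<omega> * 1)"
  proof (intro sum_mono mult_left_mono p0)
    fix \<omega> assume w: "\<omega> \<in> \<Omega>"
    show "r \<omega> * (1 + c * Q \<omega>) + c * Q \<omega> \<le> 1"
      using scalar_inequality[of "10/9 * Q \<omega>"] Q0[OF w] Q1[OF w]
      by (simp add: r_def c_def)
  qed
  also have "\<dots> = 1" using p1 by simp
  finally have "lhs \<le> 1" .
  moreover have "lhs = (\<Sum>\<omega>\<in>\<Omega>. p \<omega> * exp (k \<omega> - 10/9 * Q \<omega>)) * (\<Sum>\<omega>\<in>\<Omega>. p \<omega> * exp (- k \<omega>))"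
  proof -
    have "r \<omega> * exp (k \<omega> - k \<eta>) = exp (k \<omega> - 10/9 * Q \<omega>) * exp (- k \<eta>)" for \<omega> \<eta>
      by (simp add: r_def exp_add[symmetric])
    then show ?thesis
      unfolding lhs_def sum_product by (intro sum.cong) (simp_all add: algebra_simps)
  qed
  ultimately show ?thesis by simp
qed

section \<open>Transport in one coordinate\<close>

text \<open>
  The generalized Hoelder inequality \<open>\<integral> \<Prod>\<^sub>\<eta> F\<^sub>\<eta>\<^bsup>\<mu> \<eta>\<^esup> \<le> \<Prod>\<^sub>\<eta> (\<integral> F\<^sub>\<eta>)\<^bsup>\<mu> \<eta>\<^esup>\<close> for \<open>F\<^sub>\<eta> = exp (a \<eta>)\<close>. After
  normalizing by \<open>exp (b \<eta>)\<close> it reduces to convexity of the exponential function.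
\<close>

lemma Holder_exp:
  fixes w :: "'b \<Rightarrow> real" and \<mu> b :: "'a \<Rightarrow> real" and a :: "'a \<Rightarrow> 'b \<Rightarrow> real"
  assumes fin: "finite \<Omega>"
    and w0: "\<And>x. x \<in> X \<Longrightarrow> 0 \<le> w x"
    and \<mu>0: "\<And>\<eta>. \<eta> \<in> \<Omega> \<Longrightarrow> 0 \<le> \<mu> \<eta>" and \<mu>1: "sum \<mu> \<Omega> = 1"
    and le: "\<And>\<eta>. \<eta> \<in> \<Omega> \<Longrightarrow> \<mu> \<eta> \<noteq> 0 \<Longrightarrow> (\<Sum>x\<in>X. w x * exp (a \<eta> x)) \<le> exp (b \<eta>)"
  shows "(\<Sum>x\<in>X. w x * exp (\<Sum>\<eta>\<in>\<Omega>. \<mu> \<eta> * a \<eta> x)) \<le> exp (\<Sum>\<eta>\<in>\<Omega>. \<mu> \<eta> * b \<eta>)"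
proof -
  let ?B = "\<Sum>\<eta>\<in>\<Omega>. \<mu> \<eta> * b \<eta>"
  have "\<Omega> \<noteq> {}" using \<mu>1 by auto
  have "(\<Sum>x\<in>X. w x * exp (\<Sum>\<eta>\<in>\<Omega>. \<mu> \<eta> * a \<eta> x))
      = exp ?B * (\<Sum>x\<in>X. w x * exp (\<Sum>\<eta>\<in>\<Omega>. \<mu> \<eta> * (a \<eta> x - b \<eta>)))"
    unfolding sum_distrib_left
    by (intro sum.cong) (auto simp: exp_diff right_diff_distrib sum_subtractf)
  also have "\<dots> \<le> exp ?B * (\<Sum>x\<in>X. w x * (\<Sum>\<eta>\<in>\<Omega>. \<mu> \<eta> * exp (a \<eta> x - b \<eta>)))"
    using convex_on_sum[OF fin \<open>\<Omega> \<noteq> {}\<close> exp_convex \<mu>1 \<mu>0] w0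
    by (intro mult_left_mono sum_mono) auto
  also have "(\<Sum>x\<in>X. w x * (\<Sum>\<eta>\<in>\<Omega>. \<mu> \<eta> * exp (a \<eta> x - b \<eta>)))
      = (\<Sum>\<eta>\<in>\<Omega>. \<mu> \<eta> * (exp (- b \<eta>) * (\<Sum>x\<in>X. w x * exp (a \<eta> x))))"
    unfolding sum_distrib_left
    by (subst sum.swap) (auto intro!: sum.cong simp: exp_diff exp_minus field_simps)
  also have "\<dots> \<le> (\<Sum>\<eta>\<in>\<Omega>. \<mu> \<eta> * 1)"
  proof (rule sum_mono)
    fix \<eta> assume e: "\<eta> \<in> \<Omega>"
    show "\<mu> \<eta> * (exp (- b \<eta>) * (\<Sum>x\<in>X. w x * exp (a \<eta> x))) \<le> \<mu> \<eta> * 1"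
    proof (cases "\<mu> \<eta> = 0")
      case False
      have "exp (- b \<eta>) * (\<Sum>x\<in>X. w x * exp (a \<eta> x)) \<le> exp (- b \<eta>) * exp (b \<eta>)"
        using le[OF e False] by (intro mult_left_mono) auto
      then show ?thesis using \<mu>0[OF e]
        by (intro mult_left_mono) (auto simp: exp_add[symmetric])
    qed simp
  qed
  finally show ?thesis using \<mu>1 by simp
qed

lemma sum_PiE_insert:
  assumes "i \<notin> I"
  shows "(\<Sum>x\<in>PiE (insert i I) (\<lambda>_. \<Omega>). F x) = (\<Sum>\<omega>\<in>\<Omega>. \<Sum>x\<in>PiE I (\<lambda>_. \<Omega>). F (x(i := \<omega>)))"
  unfolding PiE_insert_eq
  by (subst sum.reindex[OF inj_combinator[OF assms]]) (simp add: sum.cartesian_product case_prod_unfold)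

text \<open>
  The truncation level for \<open>k\<close>: pouring a volume \<open>d\<close> of water over the profile \<open>k\<close>, but not higher than \<open>s\<close>
  above the lower bound \<open>a\<close>. The last alternative records which of the two constraints stopped the water.
\<close>

lemma water_level:
  fixes p k :: "'a \<Rightarrow> real"
  assumes fin: "finite \<Omega>" and p0: "\<And>\<omega>. \<omega> \<in> \<Omega> \<Longrightarrow> 0 \<le> p \<omega>"
    and k: "\<And>\<omega>. \<omega> \<in> \<Omega> \<Longrightarrow> a \<le> k \<omega>" and "0 \<le> s" "0 \<le> d"
  obtains m where "a \<le> m" "m \<le> a + s" "(\<Sum>\<eta>\<in>\<Omega>. p \<eta> * max 0 (m - k \<eta>)) \<le> d"
    "m = a + s \<or> (\<Sum>\<eta>\<in>\<Omega>. p \<eta> * max 0 (m - k \<eta>)) = d"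
proof -
  define D where "D = (\<lambda>m. \<Sum>\<eta>\<in>\<Omega>. p \<eta> * max 0 (m - k \<eta>))"
  show thesis
  proof (cases "D (a + s) \<le> d")
    case True
    then show thesis using that[of "a + s"] assms by (simp add: D_def)
  next
    case False
    have "D a = 0" unfolding D_def using k by (intro sum.neutral) (simp add: max_absorb1)
    moreover have "continuous_on {a..a+s} D"
      unfolding D_def by (intro continuous_intros)
    ultimately obtain m where "a \<le> m" "m \<le> a + s" "D m = d"
      using IVT'[of D a d "a + s"] assms False by auto
    then show thesis using that[of m] by (simp add: D_def)
  qed
qed

text \<open>
  For the induction step, \<open>g \<eta>\<close> is the probability of the section of \<open>A\<close> at \<open>\<eta>\<close> and \<open>k = - ln g\<close>. From \<open>\<omega>\<close> the
  plan \<open>\<Lambda> \<omega>\<close> sends mass \<open>20/9 p \<eta> (m \<omega> - k \<eta>)\<^sup>+\<close> to \<open>\<eta>\<close>, where \<open>m \<omega> = min (k \<omega>) l\<close>, and leaves the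
  rest \<open>r \<omega> \<ge> 0\<close> at one point: at \<open>\<omega>\<close> itself if \<open>k \<omega> \<le> l\<close>, and otherwise at a point \<open>z\<close> where
  \<open>k\<close> is minimal. In the second case either the rest is zero, because the level \<open>l\<close> was reached by
  volume, or \<open>l = k z + 9/10\<close>, and then \<open>f \<le> 9/10\<close> makes the cost of going to \<open>z\<close> at most \<open>l\<close>. In all cases
  completing the square in \<open>f\<close> shows that the total cost is at most \<open>m \<omega> - 10/9 Q \<omega>\<close>, and
  \<open>penalized_exp_moment_product\<close> applies to \<open>m\<close>, as \<open>g \<le> e\<^bsup>-m\<^esup>\<close>.
\<close>

lemma one_coordinate_transport:
  fixes \<Omega> :: "'a set" and p g :: "'a \<Rightarrow> real"
  assumes fin: "finite \<Omega>" and p0: "\<And>\<omega>. \<omega> \<in> \<Omega> \<Longrightarrow> 0 \<le> p \<omega>" and p1: "sum p \<Omega> = 1"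
    and g0: "\<And>\<omega>. \<omega> \<in> \<Omega> \<Longrightarrow> 0 \<le> g \<omega>" and ex: "\<exists>\<omega>\<in>\<Omega>. 0 < g \<omega>"
  obtains \<Lambda> :: "'a \<Rightarrow> 'a \<Rightarrow> real" and C :: "'a \<Rightarrow> real" where
    "\<And>\<omega> \<eta>. \<omega> \<in> \<Omega> \<Longrightarrow> \<eta> \<in> \<Omega> \<Longrightarrow> 0 \<le> \<Lambda> \<omega> \<eta>"
    "\<And>\<omega>. \<omega> \<in> \<Omega> \<Longrightarrow> sum (\<Lambda> \<omega>) \<Omega> = 1"
    "\<And>\<omega> \<eta>. \<omega> \<in> \<Omega> \<Longrightarrow> \<eta> \<in> \<Omega> \<Longrightarrow> \<Lambda> \<omega> \<eta> \<noteq> 0 \<Longrightarrow> 0 < g \<eta>"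
    "\<And>\<omega> f. \<omega> \<in> \<Omega> \<Longrightarrow> (\<And>\<eta>. \<eta> \<in> \<Omega> \<Longrightarrow> 0 \<le> f \<eta> \<and> f \<eta> \<le> 9/10) \<Longrightarrow>
       (\<Sum>\<eta>\<in>\<Omega>. \<Lambda> \<omega> \<eta> * (f \<eta> - f \<omega> - ln (g \<eta>))) - 10/9 * (\<Sum>\<eta>\<in>\<Omega>. p \<eta> * (f \<eta>)^2) \<le> C \<omega>"
    "(\<Sum>\<omega>\<in>\<Omega>. p \<omega> * exp (C \<omega>)) * (\<Sum>\<omega>\<in>\<Omega>. p \<omega> * g \<omega>) \<le> 1"
proof -
  have "\<exists>z\<in>\<Omega>. \<forall>\<omega>\<in>\<Omega>. g \<omega> \<le> g z"
  proof -
    have "Max (g ` \<Omega>) \<in> g ` \<Omega>" using fin ex by (intro Max_in) auto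
    then obtain z where "z \<in> \<Omega>" "g z = Max (g ` \<Omega>)" by auto
    then show ?thesis using fin by (intro bexI[of _ z]) auto
  qed
  then obtain z where z: "z \<in> \<Omega>" and zmax: "\<And>\<omega>. \<omega> \<in> \<Omega> \<Longrightarrow> g \<omega> \<le> g z" by auto
  have gz: "0 < g z" using ex zmax by force
  define a where "a = - ln (g z)"
  \<comment> \<open>Where \<open>g\<close> vanishes \<open>k\<close> should be infinite; any value above \<open>a + 9/10\<close> keeps mass away.\<close>
  define k where "k = (\<lambda>\<eta>. if g \<eta> > 0 then - ln (g \<eta>) else a + 1)"
  have ka: "a \<le> k \<eta>" if "\<eta> \<in> \<Omega>" for \<eta>
    using zmax[OF that] gz by (auto simp: k_def a_def)
  have kz: "k z = a" using gz by (simp add: k_def a_def)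
  define D where "D = (\<lambda>m. \<Sum>\<eta>\<in>\<Omega>. p \<eta> * max 0 (m - k \<eta>))"
  obtain l :: real where l: "a \<le> l" "l \<le> a + 9/10" "D l \<le> 9/20" "l = a + 9/10 \<or> D l = 9/20"
    using water_level[where \<Omega> = \<Omega> and p = p and k = k and a = a and s = "9/10" and d = "9/20"]
      fin p0 ka unfolding D_def by auto
  define m where "m = (\<lambda>\<omega>. min (k \<omega>) l)"
  define h where "h = (\<lambda>\<omega> \<eta>. max 0 (m \<omega> - k \<eta>))"
  define e where "e = (\<lambda>\<omega>. if k \<omega> \<le> l then \<omega> else z)"
  define r where "r = (\<lambda>\<omega>. 1 - 20/9 * D (m \<omega>))"
  define \<Lambda> where "\<Lambda> = (\<lambda>\<omega> \<eta>. 20/9 * (p \<eta> * h \<omega> \<eta>) + (if \<eta> = e \<omega> then r \<omega> else 0))"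
  define Q where "Q = (\<lambda>\<omega>. \<Sum>\<eta>\<in>\<Omega>. p \<eta> * (max 0 (m \<omega> - m \<eta>))^2)"
  have h_alt: "h \<omega> \<eta> = max 0 (m \<omega> - m \<eta>)" for \<omega> \<eta>
    by (auto simp: h_def m_def)
  have Dm: "D (m \<omega>) \<le> 9/20" for \<omega>
  proof -
    have "D (m \<omega>) \<le> D l"
      unfolding D_def using p0 by (intro sum_mono mult_left_mono) (auto simp: m_def)
    then show ?thesis using l by simp
  qed
  have r0: "0 \<le> r \<omega>" for \<omega> using Dm[of \<omega>] by (simp add: r_def)
  have eO: "e \<omega> \<in> \<Omega>" if "\<omega> \<in> \<Omega>" for \<omega> using that z by (simp add: e_def)
  have gpos: "0 < g \<eta>" if "k \<eta> \<le> l" for \<eta>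
    using that l by (auto simp: k_def split: if_splits)
  have sum\<Lambda>: "(\<Sum>\<eta>\<in>\<Omega>. \<Lambda> \<omega> \<eta> * X \<eta>) = 20/9 * (\<Sum>\<eta>\<in>\<Omega>. p \<eta> * h \<omega> \<eta> * X \<eta>) + r \<omega> * X (e \<omega>)"
    if "\<omega> \<in> \<Omega>" for \<omega> and X :: "'a \<Rightarrow> real"
  proof -
    have "(\<Sum>\<eta>\<in>\<Omega>. \<Lambda> \<omega> \<eta> * X \<eta>) = (\<Sum>\<eta>\<in>\<Omega>. 20/9 * (p \<eta> * h \<omega> \<eta> * X \<eta>)
        + (if \<eta> = e \<omega> then r \<omega> * X \<eta> else 0))"
      by (intro sum.cong) (auto simp: \<Lambda>_def algebra_simps)
    then show ?thesis
      using fin eO[OF that] by (simp add: sum.distrib sum_distrib_left)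
  qed
  have \<Lambda>pos: "0 < g \<eta>" if "\<Lambda> \<omega> \<eta> \<noteq> 0" for \<omega> \<eta>
  proof -
    from that have "h \<omega> \<eta> \<noteq> 0 \<or> \<eta> = e \<omega>" by (auto simp: \<Lambda>_def split: if_splits)
    then have "k \<eta> \<le> l \<or> \<eta> = z" by (auto simp: h_def m_def e_def max_def split: if_splits)
    then show ?thesis using gpos gz by auto
  qed
  show thesis
  proof (rule that[of \<Lambda> "\<lambda>\<omega>. m \<omega> - 10/9 * Q \<omega>"])
    fix \<omega> \<eta> assume "\<omega> \<in> \<Omega>" "\<eta> \<in> \<Omega>"
    then show "0 \<le> \<Lambda> \<omega> \<eta>" using p0 r0 by (simp add: \<Lambda>_def h_def)
  next
    fix \<omega> assume w: "\<omega> \<in> \<Omega>"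
    show "sum (\<Lambda> \<omega>) \<Omega> = 1"
      using sum\<Lambda>[OF w, of "\<lambda>_. 1"] by (simp add: r_def D_def h_def)
  next
    fix \<omega> \<eta> assume "\<Lambda> \<omega> \<eta> \<noteq> 0"
    then show "0 < g \<eta>" by (rule \<Lambda>pos)
  next
    fix \<omega> and f :: "'a \<Rightarrow> real"
    assume w: "\<omega> \<in> \<Omega>" and f: "\<And>\<eta>. \<eta> \<in> \<Omega> \<Longrightarrow> 0 \<le> f \<eta> \<and> f \<eta> \<le> 9/10"
    have "(\<Sum>\<eta>\<in>\<Omega>. \<Lambda> \<omega> \<eta> * (f \<eta> - f \<omega> - ln (g \<eta>))) = (\<Sum>\<eta>\<in>\<Omega>. \<Lambda> \<omega> \<eta> * (k \<eta> + f \<eta> - f \<omega>))"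
    proof (intro sum.cong refl)
      fix \<eta>
      show "\<Lambda> \<omega> \<eta> * (f \<eta> - f \<omega> - ln (g \<eta>)) = \<Lambda> \<omega> \<eta> * (k \<eta> + f \<eta> - f \<omega>)"
        using \<Lambda>pos[of \<omega> \<eta>] by (cases "\<Lambda> \<omega> \<eta> = 0") (auto simp: k_def)
    qed
    also have "\<dots> = 20/9 * (\<Sum>\<eta>\<in>\<Omega>. p \<eta> * h \<omega> \<eta> * (k \<eta> + f \<eta> - f \<omega>)) + r \<omega> * (k (e \<omega>) + f (e \<omega>) - f \<omega>)"
      by (rule sum\<Lambda>[OF w])
    also have "r \<omega> * (k (e \<omega>) + f (e \<omega>) - f \<omega>) \<le> r \<omega> * m \<omega>"
    proof (cases "k \<omega> \<le> l")
      case True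
      then show ?thesis by (simp add: e_def m_def)
    next
      case False
      then have ml: "m \<omega> = l" and ez: "e \<omega> = z" by (auto simp: m_def e_def)
      show ?thesis
      proof (cases "l = a + 9/10")
        case True
        then have "k (e \<omega>) + f (e \<omega>) - f \<omega> \<le> m \<omega>"
          using f[OF z] f[OF w] kz ml ez by simp
        then show ?thesis using r0 by (rule mult_left_mono)
      next
        case False
        then have "r \<omega> = 0" using l by (simp add: r_def ml)
        then show ?thesis by simp
      qed
    qed
    also have "20/9 * (\<Sum>\<eta>\<in>\<Omega>. p \<eta> * h \<omega> \<eta> * (k \<eta> + f \<eta> - f \<omega>))
       \<le> 20/9 * (m \<omega> * D (m \<omega>)) - 10/9 * Q \<omega> + 10/9 * (\<Sum>\<eta>\<in>\<Omega>. p \<eta> * (f \<eta>)^2)"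
    proof -
      have "20/9 * (\<Sum>\<eta>\<in>\<Omega>. p \<eta> * h \<omega> \<eta> * (k \<eta> + f \<eta> - f \<omega>))
         \<le> (\<Sum>\<eta>\<in>\<Omega>. 20/9 * m \<omega> * (p \<eta> * h \<omega> \<eta>) - 10/9 * (p \<eta> * (h \<omega> \<eta>)^2) + 10/9 * (p \<eta> * (f \<eta>)^2))"
        unfolding sum_distrib_left
      proof (rule sum_mono)
        fix \<eta> assume e: "\<eta> \<in> \<Omega>"
        have h0: "0 \<le> h \<omega> \<eta>" by (simp add: h_def)
        have hk: "h \<omega> \<eta> * k \<eta> = h \<omega> \<eta> * m \<omega> - (h \<omega> \<eta>)^2"
          by (auto simp: h_def max_def power2_eq_square algebra_simps)
        have "20/9 * (h \<omega> \<eta> * (k \<eta> + f \<eta> - f \<omega>)) \<le> 20/9 * (h \<omega> \<eta> * k \<eta>) + 20/9 * (h \<omega> \<eta> * f \<eta>)"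
          using mult_nonneg_nonneg[OF h0, of "f \<omega>"] f[OF w] by (simp add: algebra_simps)
        also have "20/9 * (h \<omega> \<eta> * f \<eta>) \<le> 10/9 * (h \<omega> \<eta>)^2 + 10/9 * (f \<eta>)^2"
          using zero_le_power2[of "h \<omega> \<eta> - f \<eta>"] by (simp add: power2_diff)
        finally have "20/9 * (h \<omega> \<eta> * (k \<eta> + f \<eta> - f \<omega>))
           \<le> 20/9 * (h \<omega> \<eta> * m \<omega>) - 10/9 * (h \<omega> \<eta>)^2 + 10/9 * (f \<eta>)^2"
          unfolding hk right_diff_distrib by linarith
        from mult_left_mono[OF this p0[OF e]]
        show "20/9 * (p \<eta> * h \<omega> \<eta> * (k \<eta> + f \<eta> - f \<omega>))
          \<le> 20/9 * m \<omega> * (p \<eta> * h \<omega> \<eta>) - 10/9 * (p \<eta> * (h \<omega> \<eta>)^2) + 10/9 * (p \<eta> * (f \<eta>)^2)"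
          by (simp add: algebra_simps)
      qed
      also have "\<dots> = 20/9 * (m \<omega> * D (m \<omega>)) - 10/9 * Q \<omega> + 10/9 * (\<Sum>\<eta>\<in>\<Omega>. p \<eta> * (f \<eta>)^2)"
      proof -
        have "D (m \<omega>) = (\<Sum>\<eta>\<in>\<Omega>. p \<eta> * h \<omega> \<eta>)" by (simp add: D_def h_def)
        moreover have "Q \<omega> = (\<Sum>\<eta>\<in>\<Omega>. p \<eta> * (h \<omega> \<eta>)^2)" by (simp add: Q_def h_alt)
        ultimately show ?thesis
          unfolding sum.distrib sum_subtractf sum_distrib_left[symmetric] by simp
      qed
      finally show ?thesis .
    qed
    finally show "(\<Sum>\<eta>\<in>\<Omega>. \<Lambda> \<omega> \<eta> * (f \<eta> - f \<omega> - ln (g \<eta>))) - 10/9 * (\<Sum>\<eta>\<in>\<Omega>. p \<eta> * (f \<eta>)^2)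
        \<le> m \<omega> - 10/9 * Q \<omega>"
      by (simp add: r_def algebra_simps)
  next
    have "(\<Sum>\<omega>\<in>\<Omega>. p \<omega> * exp (m \<omega> - 10/9 * Q \<omega>)) * (\<Sum>\<omega>\<in>\<Omega>. p \<omega> * g \<omega>)
       \<le> (\<Sum>\<omega>\<in>\<Omega>. p \<omega> * exp (m \<omega> - 10/9 * Q \<omega>)) * (\<Sum>\<omega>\<in>\<Omega>. p \<omega> * exp (- m \<omega>))"
    proof (intro mult_left_mono sum_mono sum_nonneg)
      fix \<omega> assume w: "\<omega> \<in> \<Omega>"
      show "g \<omega> \<le> exp (- m \<omega>)"
      proof (cases "g \<omega> > 0")
        case True
        then have "m \<omega> \<le> - ln (g \<omega>)" by (simp add: m_def k_def)
        then have "exp (ln (g \<omega>)) \<le> exp (- m \<omega>)" by simp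
        then show ?thesis using True by simp
      next
        case False
        then show ?thesis using order_trans[OF _ exp_ge_zero] by (meson not_less)
      qed
    qed (use p0 in auto)
    also have "\<dots> \<le> 1"
      unfolding Q_def
    proof (rule penalized_exp_moment_product[OF fin p0 p1])
      fix \<omega> \<eta> assume "\<omega> \<in> \<Omega>" "\<eta> \<in> \<Omega>"
      then show "m \<omega> - m \<eta> \<le> 9/10" using ka[of \<eta>] l by (auto simp: m_def)
    next
      fix \<omega> assume "\<omega> \<in> \<Omega>"
      show "(\<Sum>\<eta>\<in>\<Omega>. p \<eta> * max 0 (m \<omega> - m \<eta>)) \<le> 9/20"
        using Dm[of \<omega>] by (simp add: h_alt[symmetric] h_def D_def)
    qed
    finally show "(\<Sum>\<omega>\<in>\<Omega>. p \<omega> * exp (m \<omega> - 10/9 * Q \<omega>)) * (\<Sum>\<omega>\<in>\<Omega>. p \<omega> * g \<omega>) \<le> 1" .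
  qed
qed

section \<open>Concentration on product spaces\<close>

text \<open>
  The function \<open>G x\<close> may depend arbitrarily on \<open>x\<close>. This freedom is what carries the induction: once the
  coordinate \<open>i\<close> of \<open>x\<close> is fixed to \<open>\<omega>\<close>, the functions \<open>G (x(i := \<omega>))\<close> are again an admissible family on the
  smaller product, the same one for every section of \<open>A\<close>.
\<close>

lemma transport_concentration:
  fixes \<Omega> :: "'a set" and p :: "'a \<Rightarrow> real" and I :: "'i set"
  assumes fin: "finite \<Omega>" and p0: "\<And>\<omega>. \<omega> \<in> \<Omega> \<Longrightarrow> 0 \<le> p \<omega>" and p1: "sum p \<Omega> = 1"
    and "finite I"
    and "A \<subseteq> PiE I (\<lambda>_. \<Omega>)"
    and "\<And>x \<omega>. x \<in> PiE I (\<lambda>_. \<Omega>) \<Longrightarrow> \<omega> \<in> \<Omega> \<Longrightarrow> 0 \<le> G x \<omega> \<and> G x \<omega> \<le> 9/10"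
    and "\<And>x y. x \<in> PiE I (\<lambda>_. \<Omega>) \<Longrightarrow> y \<in> A \<Longrightarrow>
       c x \<le> (\<Sum>j\<in>I. G x (y j) - G x (x j)) - 10/9 * card I * (\<Sum>\<omega>\<in>\<Omega>. p \<omega> * (G x \<omega>)^2)"
  shows "(\<Sum>x\<in>PiE I (\<lambda>_. \<Omega>). (\<Prod>j\<in>I. p (x j)) * exp (c x)) * (\<Sum>x\<in>A. \<Prod>j\<in>I. p (x j)) \<le> 1"
  using assms(4-)
proof (induction I arbitrary: A G c rule: finite_induct)
  case empty
  show ?case
  proof (cases "A = {}")
    case False
    then have "A = {\<lambda>_. undefined}" using empty.prems(1) by auto
    then show ?thesis using empty.prems(3)[of "\<lambda>_. undefined" "\<lambda>_. undefined"] by simp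
  qed simp
next
  case (insert i I)
  let ?X = "PiE I (\<lambda>_. \<Omega>)"
  define w where "w = (\<lambda>x. \<Prod>j\<in>I. p (x j))"
  define B where "B = (\<lambda>\<eta>. {x \<in> ?X. x(i := \<eta>) \<in> A})"
  define g where "g = (\<lambda>\<eta>. \<Sum>x\<in>B \<eta>. w x)"
  have finX: "finite ?X" using insert.hyps fin by (intro finite_PiE) auto
  have finB: "finite (B \<eta>)" for \<eta> using finX by (simp add: B_def)
  have w0: "0 \<le> w x" if "x \<in> ?X" for x
    unfolding w_def using that p0 by (intro prod_nonneg) auto
  have w_ins: "(\<Prod>j\<in>insert i I. p ((x(i := \<omega>)) j)) = p \<omega> * w x" for x \<omega>
  proof -
    have "(\<Prod>j\<in>I. p ((x(i := \<omega>)) j)) = w x"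
      unfolding w_def using insert.hyps by (intro prod.cong) auto
    then show ?thesis using insert.hyps by simp
  qed
  have X_ins: "x(i := \<omega>) \<in> PiE (insert i I) (\<lambda>_. \<Omega>)" if "x \<in> ?X" "\<omega> \<in> \<Omega>" for x \<omega>
    using that by (auto simp: PiE_insert_eq)
  have g0: "0 \<le> g \<eta>" for \<eta>
    unfolding g_def using w0 by (intro sum_nonneg) (auto simp: B_def)
  have sumA: "(\<Sum>x\<in>A. \<Prod>j\<in>insert i I. p (x j)) = (\<Sum>\<eta>\<in>\<Omega>. p \<eta> * g \<eta>)"
  proof -
    have "(\<Sum>x\<in>A. \<Prod>j\<in>insert i I. p (x j))
        = (\<Sum>x\<in>PiE (insert i I) (\<lambda>_. \<Omega>). if x \<in> A then \<Prod>j\<in>insert i I. p (x j) else 0)"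
    proof -
      have "finite (PiE (insert i I) (\<lambda>_. \<Omega>))" using insert.hyps fin by (intro finite_PiE) auto
      then show ?thesis
        using insert.prems(1) by (simp add: sum.inter_restrict[symmetric] Int_absorb1)
    qed
    also have "\<dots> = (\<Sum>\<eta>\<in>\<Omega>. \<Sum>x\<in>?X. if x(i := \<eta>) \<in> A then p \<eta> * w x else 0)"
      unfolding sum_PiE_insert[OF insert.hyps(2)] w_ins ..
    also have "\<dots> = (\<Sum>\<eta>\<in>\<Omega>. p \<eta> * g \<eta>)"
      unfolding g_def B_def sum_distrib_left using finX by (simp add: sum.inter_filter)
    finally show ?thesis .
  qed
  show ?case
  proof (cases "\<exists>\<eta>\<in>\<Omega>. 0 < g \<eta>")
    case False
    then have "(\<Sum>\<eta>\<in>\<Omega>. p \<eta> * g \<eta>) = 0" using g0 by (intro sum.neutral) (metis less_eq_real_def mult_zero_right)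
    then show ?thesis unfolding sumA by simp
  next
    case True
    obtain \<Lambda> C where
        \<Lambda>0: "\<And>\<omega> \<eta>. \<omega> \<in> \<Omega> \<Longrightarrow> \<eta> \<in> \<Omega> \<Longrightarrow> 0 \<le> \<Lambda> \<omega> \<eta>"
      and \<Lambda>1: "\<And>\<omega>. \<omega> \<in> \<Omega> \<Longrightarrow> sum (\<Lambda> \<omega>) \<Omega> = 1"
      and \<Lambda>g: "\<And>\<omega> \<eta>. \<omega> \<in> \<Omega> \<Longrightarrow> \<eta> \<in> \<Omega> \<Longrightarrow> \<Lambda> \<omega> \<eta> \<noteq> 0 \<Longrightarrow> 0 < g \<eta>"
      and cost: "\<And>\<omega> f. \<omega> \<in> \<Omega> \<Longrightarrow> (\<And>\<eta>. \<eta> \<in> \<Omega> \<Longrightarrow> 0 \<le> f \<eta> \<and> f \<eta> \<le> 9/10) \<Longrightarrow>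
          (\<Sum>\<eta>\<in>\<Omega>. \<Lambda> \<omega> \<eta> * (f \<eta> - f \<omega> - ln (g \<eta>))) - 10/9 * (\<Sum>\<eta>\<in>\<Omega>. p \<eta> * (f \<eta>)^2) \<le> C \<omega>"
      and C: "(\<Sum>\<omega>\<in>\<Omega>. p \<omega> * exp (C \<omega>)) * (\<Sum>\<omega>\<in>\<Omega>. p \<omega> * g \<omega>) \<le> 1"
    proof (rule one_coordinate_transport[OF fin _ p1 _ True])
      fix \<Lambda> C
      assume *: "\<And>\<omega> \<eta>. \<omega> \<in> \<Omega> \<Longrightarrow> \<eta> \<in> \<Omega> \<Longrightarrow> 0 \<le> \<Lambda> \<omega> \<eta>"
        "\<And>\<omega>. \<omega> \<in> \<Omega> \<Longrightarrow> sum (\<Lambda> \<omega>) \<Omega> = 1"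
        "\<And>\<omega> \<eta>. \<omega> \<in> \<Omega> \<Longrightarrow> \<eta> \<in> \<Omega> \<Longrightarrow> \<Lambda> \<omega> \<eta> \<noteq> 0 \<Longrightarrow> 0 < g \<eta>"
        "\<And>\<omega> f. \<omega> \<in> \<Omega> \<Longrightarrow> (\<And>\<eta>. \<eta> \<in> \<Omega> \<Longrightarrow> 0 \<le> f \<eta> \<and> f \<eta> \<le> 9/10) \<Longrightarrow>
          (\<Sum>\<eta>\<in>\<Omega>. \<Lambda> \<omega> \<eta> * (f \<eta> - f \<omega> - ln (g \<eta>))) - 10/9 * (\<Sum>\<eta>\<in>\<Omega>. p \<eta> * (f \<eta>)^2) \<le> C \<omega>"
        "(\<Sum>\<omega>\<in>\<Omega>. p \<omega> * exp (C \<omega>)) * (\<Sum>\<omega>\<in>\<Omega>. p \<omega> * g \<omega>) \<le> 1"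
      show thesis by (rule that[OF *])
    qed (use p0 g0 in auto)
    \<comment> \<open>It suffices to integrate out the old coordinates for each value \<open>\<omega>\<close> of the new one; \<open>C\<close> then
      takes care of the integral over \<open>\<omega>\<close>.\<close>
    have slice: "(\<Sum>x\<in>?X. w x * exp (c (x(i := \<omega>)))) \<le> exp (C \<omega>)" if \<omega>: "\<omega> \<in> \<Omega>" for \<omega>
    proof -
      define f where "f = (\<lambda>x. G (x(i := \<omega>)))"
      define V where "V = (\<lambda>x. \<Sum>\<eta>\<in>\<Omega>. p \<eta> * (f x \<eta>)^2)"
      define d where "d = (\<lambda>x y. (\<Sum>j\<in>I. f x (y j) - f x (x j)) - 10/9 * card I * V x)"
      define a where "a = (\<lambda>\<eta> x. Min (d x ` B \<eta>))"
      have f: "0 \<le> f x \<eta> \<and> f x \<eta> \<le> 9/10" if "x \<in> ?X" "\<eta> \<in> \<Omega>" for x \<eta>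
        using insert.prems(2)[OF X_ins[OF that(1) \<omega>] that(2)] unfolding f_def .
      have IH: "(\<Sum>x\<in>?X. w x * exp (a \<eta> x)) \<le> exp (- ln (g \<eta>))" if "0 < g \<eta>" for \<eta>
      proof -
        have "(\<Sum>x\<in>?X. (\<Prod>j\<in>I. p (x j)) * exp (a \<eta> x)) * (\<Sum>x\<in>B \<eta>. \<Prod>j\<in>I. p (x j)) \<le> 1"
        proof (rule insert.IH[where G = f])
          show "B \<eta> \<subseteq> ?X" by (auto simp: B_def)
        next
          fix x y assume "x \<in> ?X" "y \<in> B \<eta>"
          then show "a \<eta> x \<le> (\<Sum>j\<in>I. f x (y j) - f x (x j))
              - 10/9 * card I * (\<Sum>\<omega>\<in>\<Omega>. p \<omega> * (f x \<omega>)^2)"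
            using finB unfolding a_def d_def V_def by (intro Min_le) auto
        qed (use f in auto)
        then have "(\<Sum>x\<in>?X. w x * exp (a \<eta> x)) * g \<eta> \<le> 1"
          by (simp add: w_def g_def)
        then show ?thesis using that by (simp add: exp_minus field_simps)
      qed
      have c_le: "c (x(i := \<omega>)) \<le> a \<eta> x + (f x \<eta> - f x \<omega>) - 10/9 * V x"
        if x: "x \<in> ?X" and \<eta>: "\<eta> \<in> \<Omega>" "0 < g \<eta>" for x \<eta>
      proof -
        have "B \<eta> \<noteq> {}" using \<eta>(2) by (auto simp: g_def)
        then have "a \<eta> x \<in> d x ` B \<eta>" unfolding a_def using finB by (intro Min_in) auto
        then obtain y where y: "y \<in> B \<eta>" "a \<eta> x = d x y" by auto
        have "(\<Sum>j\<in>insert i I. f x ((y(i := \<eta>)) j) - f x ((x(i := \<omega>)) j))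
            = (f x \<eta> - f x \<omega>) + (\<Sum>j\<in>I. f x (y j) - f x (x j))"
        proof -
          have "(\<Sum>j\<in>I. f x ((y(i := \<eta>)) j) - f x ((x(i := \<omega>)) j)) = (\<Sum>j\<in>I. f x (y j) - f x (x j))"
            using insert.hyps by (intro sum.cong) auto
          then show ?thesis using insert.hyps by simp
        qed
        moreover have "y(i := \<eta>) \<in> A" using y by (simp add: B_def)
        then have "c (x(i := \<omega>)) \<le> (\<Sum>j\<in>insert i I. f x ((y(i := \<eta>)) j) - f x ((x(i := \<omega>)) j))
            - 10/9 * card (insert i I) * V x"
          unfolding f_def V_def by (rule insert.prems(3)[OF X_ins[OF x \<omega>]])
        moreover have "real (card (insert i I)) = card I + 1" using insert.hyps by simp
        ultimately show ?thesis using y(2) by (simp add: d_def algebra_simps add_divide_distrib)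
      qed
      define K where "K = (\<Sum>\<eta>\<in>\<Omega>. \<Lambda> \<omega> \<eta> * (- ln (g \<eta>)))"
      have bound: "c (x(i := \<omega>)) \<le> (C \<omega> - K) + (\<Sum>\<eta>\<in>\<Omega>. \<Lambda> \<omega> \<eta> * a \<eta> x)" if x: "x \<in> ?X" for x
      proof -
        have "c (x(i := \<omega>)) = (\<Sum>\<eta>\<in>\<Omega>. \<Lambda> \<omega> \<eta> * c (x(i := \<omega>)))"
          by (simp add: sum_distrib_right[symmetric] \<Lambda>1[OF \<omega>])
        also have "\<dots> \<le> (\<Sum>\<eta>\<in>\<Omega>. \<Lambda> \<omega> \<eta> * (a \<eta> x + (f x \<eta> - f x \<omega>) - 10/9 * V x))"
        proof (rule sum_mono)
          fix \<eta> assume \<eta>: "\<eta> \<in> \<Omega>"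
          show "\<Lambda> \<omega> \<eta> * c (x(i := \<omega>)) \<le> \<Lambda> \<omega> \<eta> * (a \<eta> x + (f x \<eta> - f x \<omega>) - 10/9 * V x)"
          proof (cases "\<Lambda> \<omega> \<eta> = 0")
            case False
            from c_le[OF x \<eta> \<Lambda>g[OF \<omega> \<eta> False]] \<Lambda>0[OF \<omega> \<eta>] show ?thesis by (rule mult_left_mono)
          qed simp
        qed
        also have "\<dots> = (\<Sum>\<eta>\<in>\<Omega>. \<Lambda> \<omega> \<eta> * a \<eta> x + \<Lambda> \<omega> \<eta> * (f x \<eta> - f x \<omega> - ln (g \<eta>))
            - \<Lambda> \<omega> \<eta> * (- ln (g \<eta>)) - 10/9 * V x * \<Lambda> \<omega> \<eta>)"
          by (intro sum.cong) (auto simp: algebra_simps)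
        also have "\<dots> = (\<Sum>\<eta>\<in>\<Omega>. \<Lambda> \<omega> \<eta> * a \<eta> x)
            + (\<Sum>\<eta>\<in>\<Omega>. \<Lambda> \<omega> \<eta> * (f x \<eta> - f x \<omega> - ln (g \<eta>))) - K - 10/9 * V x"
          by (simp only: sum.distrib sum_subtractf sum_distrib_left[symmetric] \<Lambda>1[OF \<omega>] K_def mult_1_right)
        also have "\<dots> \<le> (C \<omega> - K) + (\<Sum>\<eta>\<in>\<Omega>. \<Lambda> \<omega> \<eta> * a \<eta> x)"
          using cost[OF \<omega>, of "f x"] f[OF x] unfolding V_def by simp
        finally show ?thesis .
      qed
      have "(\<Sum>x\<in>?X. w x * exp (c (x(i := \<omega>))))
          \<le> (\<Sum>x\<in>?X. w x * exp ((C \<omega> - K) + (\<Sum>\<eta>\<in>\<Omega>. \<Lambda> \<omega> \<eta> * a \<eta> x)))"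
        using bound w0 by (intro sum_mono mult_left_mono) auto
      also have "\<dots> = exp (C \<omega> - K) * (\<Sum>x\<in>?X. w x * exp (\<Sum>\<eta>\<in>\<Omega>. \<Lambda> \<omega> \<eta> * a \<eta> x))"
        by (simp add: exp_add sum_distrib_left mult_ac)
      also have "\<dots> \<le> exp (C \<omega> - K) * exp K"
        unfolding K_def using fin w0 \<Lambda>0 \<Lambda>1 \<omega> IH \<Lambda>g
        by (intro mult_left_mono Holder_exp) auto
      finally show ?thesis by (simp add: exp_add[symmetric])
    qed
    have "(\<Sum>x\<in>PiE (insert i I) (\<lambda>_. \<Omega>). (\<Prod>j\<in>insert i I. p (x j)) * exp (c x))
        = (\<Sum>\<omega>\<in>\<Omega>. p \<omega> * (\<Sum>x\<in>?X. w x * exp (c (x(i := \<omega>)))))"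
      unfolding sum_PiE_insert[OF insert.hyps(2)] w_ins by (simp add: sum_distrib_left mult.assoc)
    also have "\<dots> \<le> (\<Sum>\<omega>\<in>\<Omega>. p \<omega> * exp (C \<omega>))"
      using slice p0 by (intro sum_mono mult_left_mono) auto
    finally have "(\<Sum>x\<in>PiE (insert i I) (\<lambda>_. \<Omega>). (\<Prod>j\<in>insert i I. p (x j)) * exp (c x)) * (\<Sum>\<eta>\<in>\<Omega>. p \<eta> * g \<eta>)
        \<le> (\<Sum>\<omega>\<in>\<Omega>. p \<omega> * exp (C \<omega>)) * (\<Sum>\<eta>\<in>\<Omega>. p \<eta> * g \<eta>)"
      using p0 g0 by (intro mult_right_mono sum_nonneg) auto
    with C show ?thesis unfolding sumA by simp
  qed
qed

section \<open>Finite probability spaces\<close>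

lemma integral_finite_space:
  fixes f :: "'a \<Rightarrow> real"
  assumes "finite_measure P" and fin: "finite (space P)"
    and pt: "\<And>\<omega>. \<omega> \<in> space P \<Longrightarrow> {\<omega>} \<in> sets P"
  shows "integral\<^sup>L P f = (\<Sum>\<omega>\<in>space P. measure P {\<omega>} * f \<omega>)"
proof -
  interpret finite_measure P by fact
  have "integral\<^sup>L P f = (\<integral>x. (\<Sum>\<omega>\<in>space P. indicator {\<omega>} x * f \<omega>) \<partial>P)"
    using fin by (intro Bochner_Integration.integral_cong) (auto simp: indicator_def sum.delta)
  also have "\<dots> = (\<Sum>\<omega>\<in>space P. \<integral>x. indicator {\<omega>} x * f \<omega> \<partial>P)"
    using pt by (intro Bochner_Integration.integral_sum) (auto simp: less_top[symmetric])
  also have "\<dots> = (\<Sum>\<omega>\<in>space P. measure P {\<omega>} * f \<omega>)"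
    using pt by (intro sum.cong) (auto simp: Int_absorb1)
  finally show ?thesis .
qed

lemma measure_power_measure_eq_sum:
  assumes "prob_space P" and fin: "finite (space P)"
    and pt: "\<And>\<omega>. \<omega> \<in> space P \<Longrightarrow> {\<omega>} \<in> sets P"
    and B: "B \<subseteq> space (power_measure P n)"
  shows "measure (power_measure P n) B = (\<Sum>x\<in>B. \<Prod>i\<in>{1..n}. measure P {x i})"
proof -
  interpret base: prob_space P by fact
  interpret N: prob_space "power_measure P n" using assms(1) by (intro prob_space_PiM)
  interpret factors: finite_product_prob_space "\<lambda>_. P" "{1..n}" by standard simp
  have finB: "finite B"
    using B fin by (auto simp: space_PiM intro: finite_subset[OF _ finite_PiE])
  have sing: "measure (power_measure P n) {x} = (\<Prod>i\<in>{1..n}. measure P {x i})" if "x \<in> B" for x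
  proof -
    have x: "x \<in> PiE {1..n} (\<lambda>_. space P)" using that B by (auto simp: space_PiM)
    then have "{x} = (\<Pi>\<^sub>E i\<in>{1..n}. {x i})"
      by (subst PiE_singleton) (auto simp: PiE_def)
    moreover have "measure (power_measure P n) (\<Pi>\<^sub>E i\<in>{1..n}. {x i}) = (\<Prod>i\<in>{1..n}. measure P {x i})"
      using PiE_mem[OF x] pt by (intro factors.prob_times) auto
    ultimately show ?thesis by simp
  qed
  have "measure (power_measure P n) B = (\<Sum>x\<in>B. measure (power_measure P n) {x})"
    using finB B sets_power_measure_finite[OF fin pt]
    by (intro N.finite_measure_eq_sum_singleton) auto
  then show ?thesis using sing by simp
qed

text \<open>
  Markov's inequality for the sum, whose expectation is \<open>n Pf\<close>.
\<close>

lemma measure_le_expected_sum: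
  assumes "prob_space P" and f: "f \<in> borel_measurable P" "f \<in> space P \<rightarrow> {0..1::real}"
    and A: "A \<in> sets (power_measure P n)"
    and T: "\<And>y. y \<in> A \<Longrightarrow> T \<le> (\<Sum>i=1..n. f (y i))"
  shows "T * measure (power_measure P n) A \<le> real n * integral\<^sup>L P f"
proof -
  interpret base: prob_space P by fact
  interpret N: prob_space "power_measure P n" using assms(1) by (intro prob_space_PiM)
  interpret factors: product_prob_space "\<lambda>_. P" "{1..n}" ..
  let ?N = "power_measure P n"
  have meas: "(\<lambda>y. f (y i)) \<in> borel_measurable ?N" if "i \<in> {1..n}" for i
    using f(1) that by (intro measurable_compose[OF measurable_component_singleton]) auto
  have bd: "0 \<le> f (y i) \<and> f (y i) \<le> 1" if "y \<in> space ?N" "i \<in> {1..n}" for y i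
  proof -
    have "y i \<in> space P" using that by (auto simp: space_PiM PiE_iff)
    then show ?thesis using f(2) by auto
  qed
  have int: "integrable ?N (\<lambda>y. f (y i))" if "i \<in> {1..n}" for i
    using bd meas that by (intro N.integrable_const_bound[where B = 1]) auto
  have comp: "(\<integral>y. f (y i) \<partial>?N) = integral\<^sup>L P f" if "i \<in> {1..n}" for i
  proof -
    have "integral\<^sup>L P f = integral\<^sup>L (distr ?N P (\<lambda>y. y i)) f"
      using factors.PiM_component[OF that] by simp
    also have "\<dots> = (\<integral>y. f (y i) \<partial>?N)"
      using f(1) that by (intro integral_distr measurable_component_singleton) auto
    finally show ?thesis by simp
  qed
  have "T * measure ?N A = (\<integral>y. T * indicator A y \<partial>?N)"
    using A by simp
  also have "\<dots> \<le> (\<integral>y. (\<Sum>i=1..n. f (y i)) \<partial>?N)"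
  proof (rule integral_mono)
    show "integrable ?N (\<lambda>y. T * indicator A y)"
      using A N.emeasure_finite[of A]
      by (intro integrable_mult_right integrable_real_indicator) (auto simp: less_top[symmetric])
    show "integrable ?N (\<lambda>y. \<Sum>i=1..n. f (y i))" using int by auto
    fix y assume y: "y \<in> space ?N"
    show "T * indicator A y \<le> (\<Sum>i=1..n. f (y i))"
    proof (cases "y \<in> A")
      case True
      then show ?thesis using T by simp
    next
      case False
      then show ?thesis using bd[OF y] by (auto intro!: sum_nonneg)
    qed
  qed
  also have "\<dots> = real n * integral\<^sup>L P f"
    using int comp by simp
  finally show ?thesis .
qed

text \<open>
  On a finite space \<open>Z\<close> takes finitely many values, so \<open>{Z > M}\<close> is \<open>{Z \<ge> M + \<epsilon>}\<close> for some \<open>\<epsilon> > 0\<close>.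
\<close>

lemma sublevel_ge_half:
  fixes N :: "'b measure" and Z :: "'b \<Rightarrow> ereal"
  assumes "prob_space N" and fin: "finite (space N)" and all: "sets N = Pow (space N)"
    and med: "\<And>\<epsilon>::real. \<epsilon> > 0 \<Longrightarrow> measure N {x \<in> space N. Z x \<ge> ereal (M + \<epsilon>)} < 1 / 2"
  shows "measure N {x \<in> space N. Z x \<le> ereal M} \<ge> 1 / 2"
proof -
  interpret prob_space N by fact
  define U where "U = {x \<in> space N. ereal M < Z x}"
  have "\<exists>\<epsilon>::real. \<epsilon> > 0 \<and> (\<forall>x\<in>U. ereal (M + \<epsilon>) \<le> Z x)"
  proof (cases "U = {}")
    case True
    then show ?thesis by (intro exI[of _ 1]) auto
  next
    case False
    have finU: "finite U" using fin by (simp add: U_def)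
    then have "ereal M < Min (Z ` U)" using False by (auto simp: U_def)
    then obtain t where t: "ereal M < ereal t" "ereal t < Min (Z ` U)"
      using ereal_dense2 by blast
    then have "ereal t \<le> Z x" if "x \<in> U" for x
      using finU that by (meson Min_le finite_imageI imageI less_imp_le order_trans)
    then show ?thesis using t by (intro exI[of _ "t - M"]) auto
  qed
  then obtain \<epsilon> :: real where \<epsilon>: "\<epsilon> > 0" "\<And>x. x \<in> U \<Longrightarrow> ereal (M + \<epsilon>) \<le> Z x" by blast
  have "measure N U \<le> measure N {x \<in> space N. Z x \<ge> ereal (M + \<epsilon>)}"
    using \<epsilon>(2) all by (intro finite_measure_mono) (auto simp: U_def)
  also have "\<dots> < 1/2" using \<epsilon>(1) by (rule med)
  finally have "measure N U < 1/2" .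
  moreover have "{x \<in> space N. Z x \<le> ereal M} = space N - U" by (auto simp: U_def)
  moreover have "prob (space N - U) = 1 - prob U" by (rule prob_compl) (auto simp: all U_def)
  ultimately show ?thesis by simp
qed

section \<open>The deviation inequality\<close>

theorem theorem2:
  fixes P :: "'a measure"
    and n :: nat
    and F :: "('a \<Rightarrow> real) set"
    and \<phi> :: "('a \<Rightarrow> real) \<Rightarrow> real"
    and M L u :: real
  assumes "prob_space P"
    and "finite (space P)"
    and "\<And>\<omega>. \<omega> \<in> space P \<Longrightarrow> {\<omega>} \<in> sets P"
    and "\<And>\<omega>. \<omega> \<in> space P \<Longrightarrow> measure P {\<omega>} > 0"
    and "n \<ge> 1"
    and "F \<subseteq> borel_measurable P"
    and "\<And>f. f \<in> F \<Longrightarrow> f \<in> space P \<rightarrow> {0..1}"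
    and "\<And>f. f \<in> F \<Longrightarrow> \<phi> f > 0"
    and "measure (power_measure P n)
           {x \<in> space (power_measure P n). sup_dev P n F \<phi> x \<ge> ereal M} \<le> 1 / 2"
    and "\<And>\<epsilon>::real. \<epsilon> > 0 \<Longrightarrow>
           measure (power_measure P n)
             {x \<in> space (power_measure P n). sup_dev P n F \<phi> x \<ge> ereal (M + \<epsilon>)} < 1 / 2"
    and "L > 0"
    and "2 * L * (exp (1 / L) - 1) / (1 + 2 * L) \<le> 1"
    and "u > 0"
  shows "measure (power_measure P n)
           {x \<in> space (power_measure P n). \<exists>f\<in>F.
              (\<Sum>i=1..n. (integral\<^sup>L P f - f (x i)))
                \<ge> M * \<phi> f + 2 * sqrt (L * real n * u * integral\<^sup>L P f)}
         \<le> 2 * exp (- u)"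
proof -
  note fin = assms(2) and pt = assms(3) and pos = assms(4) and n = assms(5) and u = assms(13)
  interpret prob_space P by fact
  interpret N: prob_space "power_measure P n" using assms(1) by (intro prob_space_PiM)
  let ?N = "power_measure P n"
  let ?\<Omega> = "space P"
  define p where "p = (\<lambda>\<omega>. measure P {\<omega>})"
  define A where "A = {x \<in> space ?N. sup_dev P n F \<phi> x \<le> ereal M}"
  define Bad where "Bad = {x \<in> space ?N. \<exists>f\<in>F. (\<Sum>i=1..n. (integral\<^sup>L P f - f (x i)))
                \<ge> M * \<phi> f + 2 * sqrt (L * real n * u * integral\<^sup>L P f)}"
  have L: "10/9 \<le> L" using assms(11,12) by (rule constant_ge)
  have space_N: "space ?N = PiE {1..n} (\<lambda>_. ?\<Omega>)" by (simp add: space_PiM)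
  have finN: "finite (space ?N)" unfolding space_N using fin by (intro finite_PiE) auto
  have setsN: "sets ?N = Pow (space ?N)" by (rule sets_power_measure_finite[OF fin pt])
  have integ: "integral\<^sup>L P f = (\<Sum>\<omega>\<in>?\<Omega>. p \<omega> * f \<omega>)" for f :: "'a \<Rightarrow> real"
    unfolding p_def using fin pt by (intro integral_finite_space) unfold_locales
  have p1: "sum p ?\<Omega> = 1"
    using integ[of "\<lambda>_. 1"] prob_space by simp
  have A_half: "1/2 \<le> measure ?N A"
    unfolding A_def using finN setsN assms(10) N.prob_space_axioms
    by (intro sublevel_ge_half) auto
  have A_le: "(\<Sum>i=1..n. (integral\<^sup>L P f - f (y i))) \<le> M * \<phi> f" if f: "f \<in> F" and y: "y \<in> A" for f y
  proof -
    have "ereal ((1 / \<phi> f) * (\<Sum>i=1..n. (integral\<^sup>L P f - f (y i)))) \<le> sup_dev P n F \<phi> y"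
      unfolding sup_dev_def using f by (rule SUP_upper)
    also have "\<dots> \<le> ereal M" using y by (simp add: A_def)
    finally show ?thesis using assms(8)[OF f] by (simp add: field_simps)
  qed
  define separates where "separates = (\<lambda>x h. (\<forall>\<omega>\<in>?\<Omega>. 0 \<le> h \<omega> \<and> h \<omega> \<le> 9/10) \<and>
      (\<forall>y\<in>A. u \<le> (\<Sum>i\<in>{1..n}. h (y i) - h (x i)) - 10/9 * card {1..n} * (\<Sum>\<omega>\<in>?\<Omega>. p \<omega> * (h \<omega>)^2)))"
  \<comment> \<open>Every bad point is separated from \<open>A\<close> by a multiple of the function that makes it bad.\<close>
  have "\<exists>h. separates x h" if x: "x \<in> Bad" for x
  proof -
    obtain f where f: "f \<in> F"
      and dev: "(\<Sum>i=1..n. (integral\<^sup>L P f - f (x i))) \<ge> M * \<phi> f + 2 * sqrt (L * real n * u * integral\<^sup>L P f)"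
      using x unfolding Bad_def by auto
    define q where "q = integral\<^sup>L P f"
    have f01: "0 \<le> f \<omega> \<and> f \<omega> \<le> 1" if "\<omega> \<in> ?\<Omega>" for \<omega>
      using assms(7)[OF f] that by auto
    have in_sp: "y i \<in> ?\<Omega>" if "y \<in> space ?N" "i \<in> {1..n}" for y i
      using that by (auto simp: space_PiM PiE_iff)
    have xN: "x \<in> space ?N" using x by (simp add: Bad_def)
    have q0: "0 \<le> q"
      unfolding q_def integ using f01 by (intro sum_nonneg) (auto simp: p_def)
    have gap: "2 * sqrt (L * real n * u * q) \<le> (\<Sum>i=1..n. f (y i) - f (x i))" if "y \<in> A" for y
      using A_le[OF f that] dev by (simp add: sum_subtractf q_def)
    have "q \<noteq> 0"
    proof
      assume "q = 0"
      then have "\<forall>\<omega>\<in>?\<Omega>. p \<omega> * f \<omega> = 0"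
        unfolding q_def integ using fin f01
        by (subst (asm) sum_nonneg_eq_0_iff) (auto simp: p_def)
      then have f_zero: "f \<omega> = 0" if "\<omega> \<in> ?\<Omega>" for \<omega>
        using pos[OF that] that by (auto simp: p_def)
      have dev0: "(\<Sum>i=1..n. (integral\<^sup>L P f - f (y i))) = 0" if "y \<in> space ?N" for y
        using \<open>q = 0\<close> f_zero in_sp[OF that] by (simp add: q_def)
      have "M * \<phi> f \<le> 0" using dev dev0[OF xN] \<open>q = 0\<close> by (simp add: q_def)
      then have "M \<le> 0" using assms(8)[OF f] by (simp add: mult_le_0_iff)
      have "ereal M \<le> sup_dev P n F \<phi> y" if "y \<in> space ?N" for y
      proof -
        have "ereal M \<le> ereal ((1 / \<phi> f) * (\<Sum>i=1..n. (integral\<^sup>L P f - f (y i))))"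
          unfolding dev0[OF that] using \<open>M \<le> 0\<close> by simp
        also have "\<dots> \<le> sup_dev P n F \<phi> y"
          unfolding sup_dev_def using f by (rule SUP_upper)
        finally show ?thesis .
      qed
      then have "{y \<in> space ?N. sup_dev P n F \<phi> y \<ge> ereal M} = space ?N" by auto
      then show False using assms(9) N.prob_space by simp
    qed
    with q0 have q: "0 < q" by simp
    \<comment> \<open>For larger \<open>u\<close> the separation exceeds \<open>2 n q\<close>, twice the expectation of \<open>\<Sum>\<^sub>i f (y i)\<close>, on
      a set of probability at least \<open>1/2\<close>.\<close>
    have small: "u \<le> 9/10 * (n * q)"
    proof (rule ccontr)
      assume "\<not> u \<le> 9/10 * (n * q)"
      then have "9/10 * (n * q) < u" by simp
      have nq: "0 < n * q" using n q by simp
      have "(n * q)^2 = 10/9 * (n * q) * (9/10 * (n * q))" by (simp add: power2_eq_square)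
      also have "\<dots> < 10/9 * (n * q) * u"
        using \<open>9/10 * (n * q) < u\<close> nq by (intro mult_strict_left_mono) auto
      also have "\<dots> \<le> L * (n * q) * u"
        using L nq u by (intro mult_right_mono) auto
      finally have "n * q < sqrt (L * real n * u * q)"
        using nq by (intro real_less_rsqrt) (simp add: mult_ac)
      moreover have "2 * sqrt (L * real n * u * q) * measure ?N A \<le> real n * q"
        unfolding q_def[symmetric]
      proof -
        have "2 * sqrt (L * real n * u * q) * measure ?N A \<le> real n * integral\<^sup>L P f"
        proof (rule measure_le_expected_sum)
          fix y assume y: "y \<in> A"
          have "0 \<le> (\<Sum>i=1..n. f (x i))" using f01 in_sp[OF xN] by (intro sum_nonneg) auto
          then show "2 * sqrt (L * real n * u * q) \<le> (\<Sum>i=1..n. f (y i))"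
            using gap[OF y] by (simp add: sum_subtractf)
        qed (use assms(1,6,7) f setsN in \<open>auto simp: A_def\<close>)
        then show ?thesis by (simp add: q_def)
      qed
      moreover have "2 * sqrt (L * real n * u * q) * (1/2) \<le> 2 * sqrt (L * real n * u * q) * measure ?N A"
        using A_half L u q by (intro mult_left_mono) auto
      ultimately show False by simp
    qed
    \<comment> \<open>The scale \<open>s\<close> maximizes \<open>2 s \<surd>(c u) - s\<^sup>2 c\<close>, with maximum \<open>u\<close>.\<close>
    define c where "c = 10/9 * (n * q)"
    define s where "s = sqrt (u / c)"
    have c: "0 < c" using n q by (simp add: c_def)
    have s2: "s^2 = u / c" using u c by (simp add: s_def)
    have s0: "0 \<le> s" using u c by (simp add: s_def)
    have s1: "s \<le> 9/10"
    proof -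
      have "s^2 \<le> (9/10)^2"
        unfolding s2 using small c by (simp add: c_def divide_simps power2_eq_square mult.commute)
      then show ?thesis by (rule power2_le_imp_le) simp
    qed
    have sR: "s * sqrt (c * u) = u"
      using u c by (simp add: s_def real_sqrt_mult[symmetric])
    have "u \<le> (\<Sum>i\<in>{1..n}. s * f (y i) - s * f (x i)) - 10/9 * card {1..n} * (\<Sum>\<omega>\<in>?\<Omega>. p \<omega> * (s * f \<omega>)^2)"
      if y: "y \<in> A" for y
    proof -
      have "(\<Sum>\<omega>\<in>?\<Omega>. p \<omega> * (s * f \<omega>)^2) \<le> (\<Sum>\<omega>\<in>?\<Omega>. s^2 * (p \<omega> * f \<omega>))"
      proof (rule sum_mono)
        fix \<omega> assume "\<omega> \<in> ?\<Omega>"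
        then have "(f \<omega>)^2 \<le> f \<omega>" using f01 by (simp add: power2_eq_square mult_left_le)
        then have "(s^2 * p \<omega>) * (f \<omega>)^2 \<le> (s^2 * p \<omega>) * f \<omega>"
          by (rule mult_left_mono) (simp add: p_def)
        then show "p \<omega> * (s * f \<omega>)^2 \<le> s^2 * (p \<omega> * f \<omega>)"
          by (simp add: power_mult_distrib mult_ac)
      qed
      also have "\<dots> = s^2 * q" by (simp add: q_def integ sum_distrib_left)
      finally have "10/9 * n * (\<Sum>\<omega>\<in>?\<Omega>. p \<omega> * (s * f \<omega>)^2) \<le> 10/9 * n * (s^2 * q)"
        by (intro mult_left_mono) auto
      also have "\<dots> = u" using n q by (simp add: s2 c_def)
      finally have var: "10/9 * n * (\<Sum>\<omega>\<in>?\<Omega>. p \<omega> * (s * f \<omega>)^2) \<le> u" .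
      have "c * u \<le> L * real n * u * q"
        using mult_right_mono[OF L, of "n * q * u"] u q by (simp add: c_def mult_ac)
      then have "2 * sqrt (c * u) \<le> (\<Sum>i=1..n. f (y i) - f (x i))"
        using gap[OF y] real_sqrt_le_mono[of "c * u" "L * real n * u * q"] by linarith
      then have "s * (2 * sqrt (c * u)) \<le> s * (\<Sum>i=1..n. f (y i) - f (x i))"
        using s0 by (rule mult_left_mono)
      then have "2 * u \<le> (\<Sum>i\<in>{1..n}. s * f (y i) - s * f (x i))"
        using sR by (simp add: sum_distrib_left right_diff_distrib)
      with var show ?thesis by simp
    qed
    moreover have "0 \<le> s * f \<omega> \<and> s * f \<omega> \<le> 9/10" if "\<omega> \<in> ?\<Omega>" for \<omega>
      using f01[OF that] s0 s1 mult_mono[of s "9/10" "f \<omega>" 1] by auto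
    ultimately show ?thesis
      unfolding separates_def by (intro exI[of _ "\<lambda>\<omega>. s * f \<omega>"]) auto
  qed
  then obtain H where sep: "\<And>x. x \<in> Bad \<Longrightarrow> separates x (H x)"
    by metis
  have H: "0 \<le> H x \<omega> \<and> H x \<omega> \<le> 9/10" if "x \<in> Bad" "\<omega> \<in> ?\<Omega>" for x \<omega>
    using sep[OF that(1)] that(2) by (simp add: separates_def)
  have H_dev: "u \<le> (\<Sum>i\<in>{1..n}. H x (y i) - H x (x i)) - 10/9 * card {1..n} * (\<Sum>\<omega>\<in>?\<Omega>. p \<omega> * (H x \<omega>)^2)"
    if "x \<in> Bad" "y \<in> A" for x y
    using sep[OF that(1)] that(2) unfolding separates_def by blast
  define c where "c = (\<lambda>x. if x \<in> Bad then u else 0)"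
  define G where "G = (\<lambda>x. if x \<in> Bad then H x else (\<lambda>_. 0))"
  have "(\<Sum>x\<in>PiE {1..n} (\<lambda>_. ?\<Omega>). (\<Prod>j\<in>{1..n}. p (x j)) * exp (c x)) * (\<Sum>x\<in>A. \<Prod>j\<in>{1..n}. p (x j)) \<le> 1"
  proof (rule transport_concentration[where G = G])
    show "A \<subseteq> PiE {1..n} (\<lambda>_. ?\<Omega>)" unfolding A_def space_N by blast
  next
    fix x y assume "y \<in> A"
    then show "c x \<le> (\<Sum>j\<in>{1..n}. G x (y j) - G x (x j))
        - 10/9 * card {1..n} * (\<Sum>\<omega>\<in>?\<Omega>. p \<omega> * (G x \<omega>)^2)"
      using H_dev[of x y] by (cases "x \<in> Bad") (simp_all add: c_def G_def)
  qed (use fin p1 H in \<open>auto simp: p_def G_def\<close>)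
  moreover have "(\<Sum>x\<in>A. \<Prod>j\<in>{1..n}. p (x j)) = measure ?N A"
    unfolding p_def using fin pt assms(1)
    by (intro measure_power_measure_eq_sum[symmetric]) (auto simp: A_def)
  moreover have "exp u * measure ?N Bad \<le> (\<Sum>x\<in>PiE {1..n} (\<lambda>_. ?\<Omega>). (\<Prod>j\<in>{1..n}. p (x j)) * exp (c x))"
  proof -
    have "measure ?N Bad = (\<Sum>x\<in>Bad. \<Prod>j\<in>{1..n}. p (x j))"
      unfolding p_def using fin pt assms(1)
      by (intro measure_power_measure_eq_sum) (auto simp: Bad_def)
    then have "exp u * measure ?N Bad = (\<Sum>x\<in>Bad. (\<Prod>j\<in>{1..n}. p (x j)) * exp (c x))"
      by (simp add: sum_distrib_left c_def mult.commute)
    also have "\<dots> \<le> (\<Sum>x\<in>space ?N. (\<Prod>j\<in>{1..n}. p (x j)) * exp (c x))"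
      using finN by (intro sum_mono2) (auto simp: Bad_def p_def intro!: prod_nonneg mult_nonneg_nonneg)
    finally show ?thesis unfolding space_N .
  qed
  ultimately have "exp u * measure ?N Bad * measure ?N A \<le> 1"
    by (smt (verit) measure_nonneg mult_right_mono)
  moreover have "exp u * measure ?N Bad * (1/2) \<le> exp u * measure ?N Bad * measure ?N A"
    using A_half by (intro mult_left_mono) auto
  ultimately have "exp u * measure ?N Bad \<le> 2" by linarith
  then have "measure ?N Bad \<le> 2 * exp (- u)"
    by (simp add: exp_minus field_simps)
  then show ?thesis by (simp add: Bad_def)
qed

end
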